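(* Fix any positive integers $k\leq n$. Let $\mathcal{A}$ be a family of $k\times n$ matrices over $\mathbb{F}_2$ that is $(n,k)$-covering, and for each $A\in\mathcal{A}$ let $M_A$ be the NFA defined in the context. Then $\bigcup_{A\in\mathcal{A}}L_\oplus(M_A)=L_k(n)$.
   Context: $L_k(n)\subseteq[n]^k$ is the set of words $w_1\cdots w_k$ with $w_1,\ldots,w_k$ all distinct. A set $\mathcal{A}$ of $k\times n$ matrices over $\mathbb{F}_2$ is $(n,k)$-covering if for every $k$ distinct column indices $i_1,\ldots,i_k\in[n]$ some $A\in\mathcal{A}$ has columns $i_1,\ldots,i_k$ linearly independent. All sums are in $\mathbb{F}_2$. For a $k\times n$ matrix $A$ with columns $v_1,\ldots,v_n\in\{0,1\}^k$ and non-empty $S\subseteq[k]$, let $T_{A,S}=\{i\in[n]:\sum_{j\in S}v_{i,j}=1\}$. The NFA $M_A$ over alphabet $[n]$ has a start state $q_0$, a single accepting state $q_k$, and for each non-empty $S\subseteq[k]$ private states $q^S_1,\ldots,q^S_{k-1}$; writing $q^S_0=q_0$ and $q^S_k=q_k$, for each $0\leq j\leq k-1$ and each $i\in T_{A,S}$ there is a transition from $q^S_j$ to $q^S_{j+1}$ labeled $i$. For an NFA $M$, its XOR-language $L_\oplus(M)$ is the set of words $w$ having an odd number of paths labeled $w$ from the start state to an accepting state. *)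

theory Defs
  imports
    "HOL-Library.Z2"
    "Jordan_Normal_Form.DL_Rank"
begin

text \<open>
  The field with two elements is the type \<open>bit\<close> of \<open>HOL-Library.Z2\<close>. The index sets
  $[n]$ and $[k]$ are rendered as \<open>{0..<n}\<close> and \<open>{0..<k}\<close>, in line with the
  0-based rows and columns of \<open>Jordan_Normal_Form\<close>.
\<close>

definition distinct_words :: "nat \<Rightarrow> nat \<Rightarrow> nat list set" where
  "distinct_words k n = {w. length w = k \<and> set w \<subseteq> {0..<n} \<and> distinct w}"

text \<open>
  The library's \<open>lin_indpt\<close> speaks about sets of vectors. Linear independence of the
  list of columns selected by \<open>is\<close> additionally requires that no vector is repeated.
\<close>

definition lin_indpt_cols :: "bit mat \<Rightarrow> nat list \<Rightarrow> bool" where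
  "lin_indpt_cols A is \<longleftrightarrow>
     distinct (map (col A) is) \<and>
     module.lin_indpt class_ring (module_vec TYPE(bit) (dim_row A)) (set (map (col A) is))"

definition covering :: "nat \<Rightarrow> nat \<Rightarrow> bit mat set \<Rightarrow> bool" where
  "covering n k \<A> \<longleftrightarrow>
     \<A> \<subseteq> carrier_mat k n \<and>
     (\<forall>is. length is = k \<and> set is \<subseteq> {0..<n} \<and> distinct is \<longrightarrow>
        (\<exists>A\<in>\<A>. lin_indpt_cols A is))"

record ('q, 'a) nfa =
  states :: "'q set"
  alphabet :: "'a set"
  start :: 'q
  accepting :: "'q set"
  transitions :: "('q \<times> 'a \<times> 'q) set"

definition wf_nfa :: "('q, 'a) nfa \<Rightarrow> bool" where
  "wf_nfa M \<longleftrightarrow>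
     finite (states M) \<and> finite (alphabet M) \<and>
     start M \<in> states M \<and> accepting M \<subseteq> states M \<and>
     transitions M \<subseteq> states M \<times> alphabet M \<times> states M"

text \<open>A path is represented by the list of the states it visits, endpoints included.\<close>

definition accepting_paths :: "('q, 'a) nfa \<Rightarrow> 'a list \<Rightarrow> 'q list set" where
  "accepting_paths M w =
     {ps. length ps = Suc (length w) \<and> ps ! 0 = start M \<and> ps ! length w \<in> accepting M \<and>
          (\<forall>i<length w. (ps ! i, w ! i, ps ! Suc i) \<in> transitions M)}"

definition xor_language :: "('q, 'a) nfa \<Rightarrow> 'a list set" where
  "xor_language M = {w \<in> lists (alphabet M). odd (card (accepting_paths M w))}"

lemma finite_accepting_paths:
  assumes "wf_nfa M"
  shows "finite (accepting_paths M w)"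
proof (rule finite_subset)
  show "accepting_paths M w \<subseteq> {ps. set ps \<subseteq> states M \<and> length ps = Suc (length w)}"
  proof
    fix ps assume ps: "ps \<in> accepting_paths M w"
    have "ps ! i \<in> states M" if "i < length ps" for i
    proof (cases i)
      case 0
      with ps assms show ?thesis by (simp add: accepting_paths_def wf_nfa_def)
    next
      case (Suc j)
      with ps that have "(ps ! j, w ! j, ps ! i) \<in> transitions M"
        by (simp add: accepting_paths_def)
      with assms show ?thesis by (auto simp: wf_nfa_def)
    qed
    with ps show "ps \<in> {ps. set ps \<subseteq> states M \<and> length ps = Suc (length w)}"
      by (auto simp: accepting_paths_def in_set_conv_nth)
  qed
  show "finite {ps. set ps \<subseteq> states M \<and> length ps = Suc (length w)}"
    using assms by (simp add: wf_nfa_def finite_lists_length_eq)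
qed

text \<open>
  \<open>Start\<close> is $q_0$, \<open>Accept\<close> is $q_k$ and \<open>Inner S j\<close>, for $1 \le j \le k-1$, is $q^S_j$;
  \<open>branch_state\<close> adds the conventions $q^S_0 = q_0$ and $q^S_k = q_k$.
  Collecting the transitions in a set merges no two of them, since for \<open>k > 1\<close> each has an
  inner endpoint that determines \<open>S\<close>, and for \<open>k = 1\<close> there is only one choice of \<open>S\<close>.
\<close>

datatype state = Start | Accept | Inner "nat set" nat

definition branch_state :: "nat \<Rightarrow> nat set \<Rightarrow> nat \<Rightarrow> state" where
  "branch_state k S j = (if j = 0 then Start else if j = k then Accept else Inner S j)"

definition parity_set :: "bit mat \<Rightarrow> nat set \<Rightarrow> nat set" where
  "parity_set A S = {i \<in> {0..<dim_col A}. (\<Sum>j\<in>S. col A i $ j) = 1}"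

definition matrix_nfa :: "bit mat \<Rightarrow> (state, nat) nfa" where
  "matrix_nfa A = (let k = dim_row A; n = dim_col A in
     \<lparr> states = {Start, Accept} \<union>
                {Inner S j | S j. S \<subseteq> {0..<k} \<and> S \<noteq> {} \<and> 1 \<le> j \<and> j \<le> k - 1},
       alphabet = {0..<n},
       start = Start,
       accepting = {Accept},
       transitions = {(branch_state k S j, i, branch_state k S (j + 1)) | S j i.
                        S \<subseteq> {0..<k} \<and> S \<noteq> {} \<and> j < k \<and> i \<in> parity_set A S} \<rparr>)"

lemma wf_matrix_nfa: "wf_nfa (matrix_nfa A)"
proof -
  let ?k = "dim_row A"
  have "{Inner S j | S j. S \<subseteq> {0..<?k} \<and> S \<noteq> {} \<and> 1 \<le> j \<and> j \<le> ?k - 1}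
        \<subseteq> case_prod Inner ` (Pow {0..<?k} \<times> {0..?k})"
    by auto
  then have "finite {Inner S j | S j. S \<subseteq> {0..<?k} \<and> S \<noteq> {} \<and> 1 \<le> j \<and> j \<le> ?k - 1}"
    by (rule finite_subset) simp
  then show ?thesis
    by (auto simp: wf_nfa_def matrix_nfa_def Let_def branch_state_def parity_set_def)
qed

end

theory Submission
  imports Defs
begin

text \<open>
  For \<open>k > 0\<close> an accepting path of $M_A$ on a word $w$ of length $k$ is the same as a set $S$ whose
  characteristic vector $x$ solves $C x = (1, \<dots>, 1)$, where the rows of the square matrix $C$ are
  the columns of $A$ selected by $w$. The solutions form either the empty set or a coset of
  $\ker C$, so over the field with two elements their number is odd iff $C$ is nonsingular.
\<close>

section \<open>Parity of the number of solutions of a linear system\<close>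

text \<open>The involution \<open>f\<close> matches the elements satisfying \<open>P\<close> with
  those violating it. An infinite \<open>X\<close> counts as even because its \<open>card\<close> is
  0.\<close>

lemma even_card_if_swapped:
  assumes "\<And>x. x \<in> X \<Longrightarrow> f x \<in> X" and "\<And>x. x \<in> X \<Longrightarrow> f (f x) = x"
    and "\<And>x. x \<in> X \<Longrightarrow> P (f x) \<longleftrightarrow> \<not> P x"
  shows "even (card X)"
proof (cases "finite X")
  case True
  have "bij_betw f {x \<in> X. P x} {x \<in> X. \<not> P x}"
    by (rule bij_betw_byWitness[where f' = f]) (use assms in auto)
  then have "card {x \<in> X. P x} = card {x \<in> X. \<not> P x}"
    by (rule bij_betw_same_card)
  moreover have "card X = card {x \<in> X. P x} + card {x \<in> X. \<not> P x}"
  proof -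
    have "X = {x \<in> X. P x} \<union> {x \<in> X. \<not> P x}" by blast
    moreover have "card \<dots> = card {x \<in> X. P x} + card {x \<in> X. \<not> P x}"
      by (rule card_Un_disjoint) (use True in auto)
    ultimately show ?thesis by simp
  qed
  ultimately show ?thesis by simp
qed simp

text \<open>If \<open>C\<close> is singular, translation by a nonzero kernel vector pairs off the
  solutions, which also covers the case of no solution; otherwise the inverse matrix yields exactly
  one solution.\<close>

lemma odd_card_solutions_iff:
  fixes C :: "bit mat"
  assumes C: "C \<in> carrier_mat k k" and b: "b \<in> carrier_vec k"
  shows "odd (card {x \<in> carrier_vec k. C *\<^sub>v x = b}) \<longleftrightarrow> det C \<noteq> 0"
proof (cases "det C = 0")
  case True
  then obtain u where u: "u \<in> carrier_vec k" "u \<noteq> 0\<^sub>v k" "C *\<^sub>v u = 0\<^sub>v k"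
    using det_0_iff_vec_prod_zero[OF C] by auto
  \<comment> \<open>Coordinate \<open>m\<close> supplies the predicate for the pairing: adding
    \<open>u\<close> flips it, since the entry of \<open>u\<close> there is 1.\<close>
  then obtain m where m: "m < k" "u $ m \<noteq> 0"
    by (metis carrier_vecD eq_vecI index_zero_vec(1,2))
  \<comment> \<open>Characteristic two makes translation by \<open>u\<close> an involution.\<close>
  have uu: "u + u = 0\<^sub>v k"
    using u by (intro eq_vecI) auto
  have "even (card {x \<in> carrier_vec k. C *\<^sub>v x = b})"
  proof (rule even_card_if_swapped[where f = "\<lambda>x. x + u" and P = "\<lambda>x. x $ m = 0"])
    fix x assume x: "x \<in> {x \<in> carrier_vec k. C *\<^sub>v x = b}"
    then show "x + u \<in> {x \<in> carrier_vec k. C *\<^sub>v x = b}"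
      using u b mult_add_distrib_mat_vec[OF C, of x u] by auto
    show "x + u + u = x"
      using x u uu by (auto simp: assoc_add_vec[of _ k])
    show "(x + u) $ m = 0 \<longleftrightarrow> x $ m \<noteq> 0"
      using m u x by (cases "x $ m"; cases "u $ m") auto
  qed
  with True show ?thesis by simp
next
  case False
  then obtain D where D: "D \<in> carrier_mat k k" "D * C = 1\<^sub>m k" "C * D = 1\<^sub>m k"
    \<comment> \<open>The argument \<open>()\<close> only fills the extension slot of the ring
      record.\<close>
    using det_non_zero_imp_unit[OF C, where b = "()"] by (auto simp: Units_def ring_mat_def)
  have "{x \<in> carrier_vec k. C *\<^sub>v x = b} = {D *\<^sub>v b}"
  proof (intro equalityI subsetI)
    fix x assume "x \<in> {x \<in> carrier_vec k. C *\<^sub>v x = b}"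
    then show "x \<in> {D *\<^sub>v b}"
      using assoc_mult_mat_vec[OF D(1) C, of x] D by auto
  next
    fix x assume "x \<in> {D *\<^sub>v b}"
    then show "x \<in> {x \<in> carrier_vec k. C *\<^sub>v x = b}"
      using assoc_mult_mat_vec[OF C D(1) b] D b by auto
  qed
  with False show ?thesis by simp
qed

section \<open>Accepting paths and branches\<close>

text \<open>All layers of the branch of \<open>S\<close> carry the same labels, so the condition
  concerns only which letters occur in \<open>w\<close>; its length is handled separately.\<close>

definition branch_sets :: "bit mat \<Rightarrow> nat list \<Rightarrow> nat set set" where
  "branch_sets A w = {S. S \<subseteq> {0..<dim_row A} \<and> S \<noteq> {} \<and> set w \<subseteq> parity_set A S}"

text \<open>The first transition fixes a branch, inner states record both branch and level, and
  \<open>Accept\<close> occurs only at level \<open>dim_row A\<close>; so a path can neither switch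
  branches nor stop at another length.\<close>

lemma accepting_path_imp_branch:
  assumes ps: "ps \<in> accepting_paths (matrix_nfa A) w" and k: "0 < dim_row A"
  shows "length w = dim_row A \<and>
    (\<exists>S \<in> branch_sets A w. ps = map (branch_state (dim_row A) S) [0..<Suc (dim_row A)])"
proof -
  let ?k = "dim_row A"
  have len: "length ps = Suc (length w)" and ps0: "ps ! 0 = Start"
    and acc: "ps ! length w = Accept"
    using ps by (auto simp: accepting_paths_def matrix_nfa_def Let_def)
  have step: "\<exists>S j. S \<subseteq> {0..<?k} \<and> S \<noteq> {} \<and> j < ?k \<and> w ! i \<in> parity_set A S \<and>
      ps ! i = branch_state ?k S j \<and> ps ! Suc i = branch_state ?k S (Suc j)"
    if "i < length w" for i
  proof -
    have "(ps ! i, w ! i, ps ! Suc i) \<in> transitions (matrix_nfa A)"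
      using ps that by (simp add: accepting_paths_def)
    then show ?thesis by (auto simp: matrix_nfa_def Let_def)
  qed
  \<comment> \<open>On the empty word a single state would have to be both \<open>Start\<close> and
    \<open>Accept\<close>.\<close>
  have w: "0 < length w"
    using ps0 acc by (cases w) auto
  obtain S j0 where S: "S \<subseteq> {0..<?k}" "S \<noteq> {}" "w ! 0 \<in> parity_set A S" "j0 < ?k"
      "ps ! 0 = branch_state ?k S j0" "ps ! Suc 0 = branch_state ?k S (Suc j0)"
    using step[OF w] by blast
  moreover from S have "j0 = 0"
    using ps0 by (simp add: branch_state_def split: if_splits)
  ultimately have S1: "ps ! Suc 0 = branch_state ?k S (Suc 0)" by simp
  have *: "i < length w \<Longrightarrow>
      i < ?k \<and> w ! i \<in> parity_set A S \<and> ps ! Suc i = branch_state ?k S (Suc i)" for i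
  proof (induction i)
    case 0
    then show ?case using S S1 k by simp
  next
    case (Suc i)
    then have IH: "i < ?k" "ps ! Suc i = branch_state ?k S (Suc i)" by auto
    obtain S' j where S': "j < ?k" "w ! Suc i \<in> parity_set A S'"
        "ps ! Suc i = branch_state ?k S' j" "ps ! Suc (Suc i) = branch_state ?k S' (Suc j)"
      using step[OF Suc.prems] by blast
    \<comment> \<open>As \<open>j < ?k\<close>, the source of this transition is not
      \<open>Accept\<close>. Hence level \<open>Suc i\<close> is an inner one, and an inner state
      determines its set and its level.\<close>
    then have "S' = S \<and> j = Suc i"
      using IH by (auto simp: branch_state_def split: if_splits)
    with S' show ?case by auto
  qed
  have states: "ps ! i = branch_state ?k S i" if "i \<le> length w" for i
    using that * ps0 by (cases i) (auto simp: branch_state_def)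
  have lw: "length w = ?k"
    using states[of "length w"] acc by (auto simp: branch_state_def split: if_splits)
  have "ps = map (branch_state ?k S) [0..<Suc ?k]"
    using len lw states by (intro nth_equalityI) (auto simp del: upt_Suc)
  moreover have "S \<in> branch_sets A w"
    using S * by (auto simp: branch_sets_def in_set_conv_nth)
  ultimately show ?thesis using lw by blast
qed

lemma branch_is_accepting_path:
  assumes "S \<in> branch_sets A w" and "length w = dim_row A" and "0 < dim_row A"
  shows "map (branch_state (dim_row A) S) [0..<Suc (dim_row A)] \<in> accepting_paths (matrix_nfa A) w"
proof -
  have "w ! i \<in> parity_set A S" if "i < dim_row A" for i
    using that assms nth_mem[of i w] by (simp add: branch_sets_def subset_iff)
  then have "(branch_state (dim_row A) S i, w ! i, branch_state (dim_row A) S (i + 1))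
      \<in> transitions (matrix_nfa A)" if "i < dim_row A" for i
    using that assms(1) unfolding matrix_nfa_def Let_def branch_sets_def by simp blast
  then show ?thesis
    using assms(2,3)
    by (simp add: accepting_paths_def matrix_nfa_def Let_def branch_state_def del: upt_Suc)
qed

text \<open>For \<open>k > 1\<close> the second state of the path is an inner one and stores the
  set. For \<open>k = 1\<close> the path is always \<open>Start\<close>, \<open>Accept\<close>, but
  \<open>{0}\<close> is the only nonempty set available.\<close>

lemma inj_on_branch:
  assumes "0 < k"
  shows "inj_on (\<lambda>S. map (branch_state k S) [0..<Suc k]) {S. S \<subseteq> {0..<k} \<and> S \<noteq> {}}"
proof (rule inj_onI)
  fix S T assume S: "S \<in> {S. S \<subseteq> {0..<k} \<and> S \<noteq> {}}" and T: "T \<in> {S. S \<subseteq> {0..<k} \<and> S \<noteq> {}}"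
    and eq: "map (branch_state k S) [0..<Suc k] = map (branch_state k T) [0..<Suc k]"
  show "S = T"
  proof (cases "k = 1")
    case True
    then have "S = {0}" "T = {0}" using S T by auto
    then show ?thesis by simp
  next
    case False
    from eq have "branch_state k S 1 = branch_state k T 1"
      using assms by (simp del: upt_Suc)
    with False show ?thesis by (simp add: branch_state_def)
  qed
qed

lemma card_accepting_paths:
  assumes "length w = dim_row A" and "0 < dim_row A"
  shows "card (accepting_paths (matrix_nfa A) w) = card (branch_sets A w)"
proof -
  let ?p = "\<lambda>S. map (branch_state (dim_row A) S) [0..<Suc (dim_row A)]"
  have "accepting_paths (matrix_nfa A) w = ?p ` branch_sets A w"
    using accepting_path_imp_branch[of _ A w] branch_is_accepting_path[of _ A w] assms by blast
  moreover have "inj_on ?p (branch_sets A w)"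
    by (rule inj_on_subset[OF inj_on_branch[OF assms(2)]]) (auto simp: branch_sets_def)
  ultimately show ?thesis by (simp only: card_image)
qed

section \<open>Branches as solutions of a linear system\<close>

abbreviation word_matrix :: "bit mat \<Rightarrow> nat list \<Rightarrow> bit mat" where
  "word_matrix A w \<equiv> mat_of_rows (dim_row A) (map (col A) w)"

text \<open>The bijection sends a set to its characteristic vector \<open>x\<close>: summing the
  entries of a column over the set is taking its scalar product with \<open>x\<close>.\<close>

lemma card_branch_sets:
  assumes "set w \<subseteq> {0..<dim_col A}" and "w \<noteq> []"
  shows "card (branch_sets A w) =
    card {x \<in> carrier_vec (dim_row A). word_matrix A w *\<^sub>v x = vec (length w) (\<lambda>_. 1)}"
proof -
  let ?k = "dim_row A"
  let ?char = "\<lambda>S. vec ?k (\<lambda>j. of_bool (j \<in> S)) :: bit vec"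
  let ?supp = "\<lambda>x. {j. j < ?k \<and> x $ j = (1 :: bit)}"
  have supp: "?supp x \<in> branch_sets A w \<longleftrightarrow> word_matrix A w *\<^sub>v x = vec (length w) (\<lambda>_. 1)"
    if x: "x \<in> carrier_vec ?k" for x
  proof -
    have scalar: "col A i \<bullet> x = (\<Sum>j\<in>?supp x. col A i $ j)" for i
    proof -
      have "col A i \<bullet> x = (\<Sum>j\<in>{0..<?k}. if x $ j = 1 then col A i $ j else 0)"
        unfolding scalar_prod_def
      proof (rule sum.cong)
        show "{0..<dim_vec x} = {0..<?k}" using x by simp
        show "col A i $ j * x $ j = (if x $ j = 1 then col A i $ j else 0)" for j
          by (cases "x $ j") simp_all
      qed
      also have "\<dots> = (\<Sum>j\<in>{j \<in> {0..<?k}. x $ j = 1}. col A i $ j)"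
        by (rule sum.inter_filter[symmetric]) simp
      finally show ?thesis by simp
    qed
    have "word_matrix A w *\<^sub>v x = vec (length w) (\<lambda>_. 1) \<longleftrightarrow>
        (\<forall>i<length w. col A (w ! i) \<bullet> x = 1)"
      by (auto simp: vec_eq_iff)
    also have "\<dots> \<longleftrightarrow> set w \<subseteq> parity_set A (?supp x)"
      using assms by (auto simp: parity_set_def scalar all_set_conv_all_nth subset_eq simp del: index_col)
    also have "\<dots> \<longleftrightarrow> ?supp x \<in> branch_sets A w"
    proof -
      \<comment> \<open>A solution cannot have empty support: \<open>w\<close> has a letter, while
        the empty sum is 0 and never 1.\<close>
      have "parity_set A {} = {}" by (simp add: parity_set_def)
      then have "set w \<subseteq> parity_set A (?supp x) \<Longrightarrow> ?supp x \<noteq> {}"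
        using assms(2) by (metis set_empty subset_empty)
      then show ?thesis by (auto simp: branch_sets_def)
    qed
    finally show ?thesis by blast
  qed
  have supp_char: "?supp (?char S) = S" if "S \<in> branch_sets A w" for S
    using that by (auto simp: branch_sets_def)
  have "bij_betw ?char (branch_sets A w)
      {x \<in> carrier_vec ?k. word_matrix A w *\<^sub>v x = vec (length w) (\<lambda>_. 1)}"
  proof (rule bij_betw_byWitness[where f' = ?supp])
    show "\<forall>S\<in>branch_sets A w. ?supp (?char S) = S"
      using supp_char by blast
    show "?char ` branch_sets A w \<subseteq>
        {x \<in> carrier_vec ?k. word_matrix A w *\<^sub>v x = vec (length w) (\<lambda>_. 1)}"
    proof
      fix x assume "x \<in> ?char ` branch_sets A w"
      then obtain S where S: "S \<in> branch_sets A w" "x = ?char S" by blast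
      then have "?supp x \<in> branch_sets A w" using supp_char[OF S(1)] by simp
      then show "x \<in> {x \<in> carrier_vec ?k. word_matrix A w *\<^sub>v x = vec (length w) (\<lambda>_. 1)}"
        using supp[of x] S by simp
    qed
  \<comment> \<open>What remains is that a vector with entries 0 and 1 is recovered from its
    support, and that supports of solutions are branch sets.\<close>
  qed (use supp in \<open>auto simp: vec_eq_iff of_bool_def\<close>)
  then show ?thesis by (rule bij_betw_same_card)
qed

text \<open>Words of any other length have no accepting path. For length \<open>dim_row A\<close>
  the numbers of paths, branch sets and solutions agree, so the determinant decides the
  parity.\<close>

lemma mem_xor_language_matrix_nfa_iff:
  assumes "0 < dim_row A"
  shows "w \<in> xor_language (matrix_nfa A) \<longleftrightarrow>
    length w = dim_row A \<and> set w \<subseteq> {0..<dim_col A} \<and> det (word_matrix A w) \<noteq> 0"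
proof -
  have alph: "w \<in> lists (alphabet (matrix_nfa A)) \<longleftrightarrow> set w \<subseteq> {0..<dim_col A}"
    by (auto simp: matrix_nfa_def Let_def)
  have len: "length w = dim_row A" if "w \<in> xor_language (matrix_nfa A)"
  proof -
    from that have "accepting_paths (matrix_nfa A) w \<noteq> {}"
      by (auto simp: xor_language_def)
    with accepting_path_imp_branch[OF _ assms] show ?thesis by blast
  qed
  have "odd (card (accepting_paths (matrix_nfa A) w)) \<longleftrightarrow> det (word_matrix A w) \<noteq> 0"
    if "length w = dim_row A" "set w \<subseteq> {0..<dim_col A}"
  proof -
    have "w \<noteq> []" using that assms by auto
    moreover have "word_matrix A w \<in> carrier_mat (dim_row A) (dim_row A)"
      using that mat_of_rows_carrier(1)[of "dim_row A" "map (col A) w"] by simp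
    ultimately show ?thesis
      using that assms card_accepting_paths[of w A] card_branch_sets[of w A]
        odd_card_solutions_iff[of "word_matrix A w" "dim_row A" "vec (length w) (\<lambda>_. 1)"]
      by simp
  qed
  with len alph show ?thesis by (auto simp: xor_language_def)
qed

section \<open>Distinct letters and independent columns\<close>

text \<open>A repeated letter would give the matrix two equal rows.\<close>

lemma det_word_matrix_nonzero_imp_distinct:
  assumes "length w = dim_row A" and "det (word_matrix A w) \<noteq> 0"
  shows "distinct w"
proof (rule ccontr)
  assume "\<not> distinct w"
  then obtain i j where ij: "i < length w" "j < length w" "i \<noteq> j" "w ! i = w ! j"
    by (auto simp: distinct_conv_nth)
  have "det (word_matrix A w) = 0"
  proof (rule det_identical_rows)
    show "word_matrix A w \<in> carrier_mat (dim_row A) (dim_row A)"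
      using assms(1) mat_of_rows_carrier(1)[of "dim_row A" "map (col A) w"] by simp
    show "row (word_matrix A w) i = row (word_matrix A w) j"
      using ij by (simp add: mat_of_rows_row)
  qed (use ij assms in auto)
  with assms(2) show False by simp
qed

text \<open>Independent columns give full rank and so a nonzero determinant, and transposing turns
  the selected columns into the rows of \<open>word_matrix A w\<close> without changing it.\<close>

lemma det_word_matrix_nonzero_if_lin_indpt_cols:
  assumes "length w = dim_row A" and "lin_indpt_cols A w"
  shows "det (word_matrix A w) \<noteq> 0"
proof -
  let ?k = "dim_row A" and ?B = "mat_of_cols (dim_row A) (map (col A) w)"
  interpret vec_space "TYPE(bit)" ?k .
  have B: "?B \<in> carrier_mat ?k ?k"
    using assms(1) mat_of_cols_carrier(1)[of ?k "map (col A) w"] by simp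
  have cols: "cols ?B = map (col A) w"
    by (rule cols_mat_of_cols) auto
  have "rank ?B = ?k"
    by (rule lin_indpt_full_rank[OF B]) (use assms(2) in \<open>simp_all add: cols lin_indpt_cols_def\<close>)
  then have "det ?B \<noteq> 0"
    using det_rank_iff[OF B] by simp
  moreover have "word_matrix A w = transpose_mat ?B"
    by (simp add: transpose_mat_of_cols)
  ultimately show ?thesis
    using det_transpose[OF B] by simp
qed

theorem theorem6p7:
  fixes k n :: nat and \<A> :: "bit mat set"
  assumes "0 < k" and "k \<le> n"
    and "covering n k \<A>"
  shows "(\<Union>A\<in>\<A>. xor_language (matrix_nfa A)) = distinct_words k n"
proof -
  have dims: "dim_row A = k" "dim_col A = n" if "A \<in> \<A>" for A
    using that assms(3) by (auto simp: covering_def)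
  have mem: "w \<in> xor_language (matrix_nfa A) \<longleftrightarrow>
      length w = k \<and> set w \<subseteq> {0..<n} \<and> det (word_matrix A w) \<noteq> 0" if "A \<in> \<A>" for A w
    using mem_xor_language_matrix_nfa_iff[of A w] dims[OF that] assms(1) by simp
  show ?thesis
  proof (intro equalityI subsetI)
    fix w assume "w \<in> (\<Union>A\<in>\<A>. xor_language (matrix_nfa A))"
    \<comment> \<open>This inclusion holds for each matrix separately: a nonzero determinant forces
      distinct letters.\<close>
    then obtain A where "A \<in> \<A>" "w \<in> xor_language (matrix_nfa A)" by blast
    then show "w \<in> distinct_words k n"
      using mem[of A w] dims[of A] det_word_matrix_nonzero_imp_distinct[of w A]
      by (simp add: distinct_words_def)
  next
    fix w assume w: "w \<in> distinct_words k n"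
    \<comment> \<open>The letters of \<open>w\<close> are an admissible choice of columns, and the
      matrix that covers them has an automaton accepting \<open>w\<close>.\<close>
    then obtain A where A: "A \<in> \<A>" "lin_indpt_cols A w"
      using assms(3) by (auto simp: covering_def distinct_words_def)
    with w have "w \<in> xor_language (matrix_nfa A)"
      using mem[of A w] dims[of A] det_word_matrix_nonzero_if_lin_indpt_cols[of w A]
      by (simp add: distinct_words_def)
    with A(1) show "w \<in> (\<Union>A\<in>\<A>. xor_language (matrix_nfa A))" by blast
  qed
qed

end
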